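(* Let $\underline P$ be a coherent and $2$-monotone lower probability on $\mathcal A(\mathbb P)$ with conjugate $\overline P$, and let $B\in\mathcal A(\mathbb P)\setminus\{\emptyset\}$. For any $A\in\mathcal A(\mathbb P)$, the regular extension $\underline R$ and the natural extension $\underline E$ satisfy $\underline R(A|B)\neq\underline E(A|B)$ if and only if $$0=\underline P(B)<\overline P(B),\qquad A^{\mathsf c}\wedge B\neq\emptyset\qquad\text{and}\qquad \overline P(A^{\mathsf c}\wedge B)=0.$$ In this case, $\underline R(A|B)=1>0=\underline E(A|B)$.
   Context: Let $\mathbb P$ be a partition (finite or infinite) of the sure event $\Omega$ and $\mathcal A(\mathbb P)$ the set of events logically dependent on $\mathbb P$, i.e. (identifying events with sets) the power set of $\mathbb P$; $\wedge,\vee,{}^{\mathsf c}$ are intersection, union, complement. "Probability" on $\mathcal A(\mathbb P)$ means finitely additive probability. A lower probability $\underline P$ on $\mathcal A(\mathbb P)$ is coherent if it is the pointwise infimum of a non-empty set of probabilities; it is $2$-monotone if $\underline P(A\vee C)+\underline P(A\wedge C)\ge\underline P(A)+\underline P(C)$ for all $A,C$. The conjugate is $\overline P(A)=1-\underline P(A^{\mathsf c})$. The credal set is $\mathcal M=\{P\text{ probability on }\mathcal A(\mathbb P):P\ge\underline P\}$. Natural extension: for $B\ne\emptyset$, let $\mathcal M_B$ be the set of pairs $(P,P(\cdot|B))$ with $P\in\mathcal M$ and $P(\cdot|B)$ a probability on $\mathcal A(\mathbb P)$ satisfying $P(B|B)=1$ and $P(A\wedge B)=P(A|B)P(B)$ for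 all $A\in\mathcal A(\mathbb P)$. Then $\underline E(A|B)=\inf_{\mathcal M_B}P(A|B)$. Regular extension: put $\mathcal M^+=\{P\in\mathcal M:P(B)>0\}$. If $\mathcal M^+\neq\varnothing$, $\underline R(A|B)=\inf_{P\in\mathcal M^+}P(A\wedge B)/P(B)$; if $\mathcal M^+=\varnothing$, $\underline R(A|B)=\underline E(A|B)$. *)

theory Defs
  imports "HOL-Analysis.Analysis" "HOL-Library.Disjoint_Sets"
begin

text \<open>
  The sure event is the union of the partition, and an event depends logically on the partition
  iff it is a union of members of it, so that the algebra of events is a copy of
  \<^term>\<open>Pow \<PP>\<close>. The lattice operations on events are those on sets; the complement of an
  event is taken in \<^term>\<open>\<Union>\<PP>\<close>.
\<close>

definition events :: "'w set set \<Rightarrow> 'w set set" where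
  "events \<PP> = {\<Union>S | S. S \<subseteq> \<PP>}"

text \<open>
  (Lower) probabilities are total functions on sets of which only the values on
  \<^term>\<open>events \<PP>\<close> matter. Probabilities are finitely, not necessarily countably, additive.
\<close>

definition is_probability :: "'w set set \<Rightarrow> ('w set \<Rightarrow> real) \<Rightarrow> bool" where
  "is_probability \<PP> P \<longleftrightarrow>
     (\<forall>A\<in>events \<PP>. 0 \<le> P A) \<and> P (\<Union>\<PP>) = 1 \<and> additive (events \<PP>) P"

definition coherent_lower :: "'w set set \<Rightarrow> ('w set \<Rightarrow> real) \<Rightarrow> bool" where
  "coherent_lower \<PP> lP \<longleftrightarrow>
     (\<exists>K. K \<noteq> {} \<and> (\<forall>P\<in>K. is_probability \<PP> P) \<and> (\<forall>A\<in>events \<PP>. lP A = (INF P\<in>K. P A)))"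

definition two_monotone :: "'w set set \<Rightarrow> ('w set \<Rightarrow> real) \<Rightarrow> bool" where
  "two_monotone \<PP> lP \<longleftrightarrow>
     (\<forall>A\<in>events \<PP>. \<forall>C\<in>events \<PP>. lP (A \<union> C) + lP (A \<inter> C) \<ge> lP A + lP C)"

definition conj_upper :: "'w set set \<Rightarrow> ('w set \<Rightarrow> real) \<Rightarrow> 'w set \<Rightarrow> real" where
  "conj_upper \<PP> lP A = 1 - lP (\<Union>\<PP> - A)"

definition credal_set :: "'w set set \<Rightarrow> ('w set \<Rightarrow> real) \<Rightarrow> ('w set \<Rightarrow> real) set" where
  "credal_set \<PP> lP = {P. is_probability \<PP> P \<and> (\<forall>A\<in>events \<PP>. lP A \<le> P A)}"

text \<open>
  In a pair \<^term>\<open>(P, Q)\<close>, \<^term>\<open>Q\<close> is the conditional probability given \<^term>\<open>B\<close>; it is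
  not determined by \<^term>\<open>P\<close> when \<^term>\<open>P B = 0\<close>.
\<close>

definition conditional_extensions ::
  "'w set set \<Rightarrow> ('w set \<Rightarrow> real) \<Rightarrow> 'w set \<Rightarrow> (('w set \<Rightarrow> real) \<times> ('w set \<Rightarrow> real)) set" where
  "conditional_extensions \<PP> lP B =
     {(P, Q). P \<in> credal_set \<PP> lP \<and> is_probability \<PP> Q \<and> Q B = 1 \<and>
              (\<forall>A\<in>events \<PP>. P (A \<inter> B) = Q A * P B)}"

definition natural_extension ::
  "'w set set \<Rightarrow> ('w set \<Rightarrow> real) \<Rightarrow> 'w set \<Rightarrow> 'w set \<Rightarrow> real" where
  "natural_extension \<PP> lP A B = (INF (P, Q)\<in>conditional_extensions \<PP> lP B. Q A)"

definition credal_set_pos ::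
  "'w set set \<Rightarrow> ('w set \<Rightarrow> real) \<Rightarrow> 'w set \<Rightarrow> ('w set \<Rightarrow> real) set" where
  "credal_set_pos \<PP> lP B = {P \<in> credal_set \<PP> lP. P B > 0}"

definition regular_extension ::
  "'w set set \<Rightarrow> ('w set \<Rightarrow> real) \<Rightarrow> 'w set \<Rightarrow> 'w set \<Rightarrow> real" where
  "regular_extension \<PP> lP A B =
     (if credal_set_pos \<PP> lP B \<noteq> {}
      then (INF P\<in>credal_set_pos \<PP> lP B. P (A \<inter> B) / P B)
      else natural_extension \<PP> lP A B)"

end

theory Submission
  imports Defs
begin

text \<open>
  For a normalized monotone 2-monotone set function \<^term>\<open>v\<close> and an event \<^term>\<open>C\<close>, the
  function \<open>X \<mapsto> v (X \<union> C) + v (X \<inter> C) - v C\<close> is of the same kind, dominates \<^term>\<open>v\<close>, and is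
  additive across \<^term>\<open>C\<close>. Hence a maximal such function, which exists by Zorn's lemma, is a
  probability, and each two-element chain of events carries a member of the credal set that
  attains the lower probability on both of its elements. If \<open>lP B = 0\<close>, a member of the credal
  set vanishing at \<^term>\<open>B\<close> leaves the conditional probability free, so the natural extension
  is 0 unless \<open>B \<subseteq> A\<close>; the regular extension is 0 as well if some member vanishes at
  \<open>A \<inter> B\<close> but not at \<open>B - A\<close>, which the chain \<open>A \<inter> B \<subseteq> \<Omega> - (B - A)\<close> provides
  whenever the upper probability of \<open>B - A\<close> is positive.
\<close>

section \<open>Events and probabilities\<close>

lemma partition_on_UNION:
  assumes "partition_on \<Omega> \<PP>"
  shows "partition_on (\<Union>\<PP>) \<PP>" "\<Omega> = \<Union>\<PP>"
  using assms by (auto simp: partition_on_def)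

lemma events_empty: "{} \<in> events \<PP>"
  unfolding events_def by (rule CollectI, rule exI[of _ "{}"]) simp

lemma events_top: "\<Union>\<PP> \<in> events \<PP>"
  unfolding events_def by blast

lemma events_subset: "A \<in> events \<PP> \<Longrightarrow> A \<subseteq> \<Union>\<PP>"
  unfolding events_def by blast

lemma events_Un:
  assumes "A \<in> events \<PP>" "C \<in> events \<PP>"
  shows "A \<union> C \<in> events \<PP>"
proof -
  obtain S T where "A = \<Union>S" "S \<subseteq> \<PP>" "C = \<Union>T" "T \<subseteq> \<PP>"
    using assms unfolding events_def by blast
  then have "A \<union> C = \<Union>(S \<union> T)" "S \<union> T \<subseteq> \<PP>" by auto
  then show ?thesis unfolding events_def by blast
qed

lemma events_Diff:
  assumes "partition_on (\<Union>\<PP>) \<PP>" "A \<in> events \<PP>"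
  shows "\<Union>\<PP> - A \<in> events \<PP>"
proof -
  obtain S where S: "A = \<Union>S" "S \<subseteq> \<PP>"
    using assms unfolding events_def by blast
  have "\<Union>\<PP> - A = \<Union>(\<PP> - S)"
    using S disjointD[OF partition_onD2[OF assms(1)]] by blast
  then show ?thesis unfolding events_def by blast
qed

lemma events_Int:
  assumes "partition_on (\<Union>\<PP>) \<PP>" "A \<in> events \<PP>" "C \<in> events \<PP>"
  shows "A \<inter> C \<in> events \<PP>"
proof -
  have "A \<inter> C = \<Union>\<PP> - ((\<Union>\<PP> - A) \<union> (\<Union>\<PP> - C))"
    using assms(2,3) by (auto dest: events_subset)
  then show ?thesis
    using assms by (metis events_Diff events_Un)
qed

section \<open>Calculus of finitely additive probabilities\<close>

lemma probability_add:
  assumes "is_probability \<PP> P" "A \<in> events \<PP>" "C \<in> events \<PP>" "A \<inter> C = {}"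
  shows "P (A \<union> C) = P A + P C"
  using assms unfolding is_probability_def additive_def by blast

lemma probability_nonneg: "is_probability \<PP> P \<Longrightarrow> A \<in> events \<PP> \<Longrightarrow> 0 \<le> P A"
  unfolding is_probability_def by blast

lemma probability_empty:
  assumes "is_probability \<PP> P"
  shows "P {} = 0"
  using probability_add[OF assms events_empty events_empty] by simp

lemma probability_compl:
  assumes "partition_on (\<Union>\<PP>) \<PP>" "is_probability \<PP> P" "A \<in> events \<PP>"
  shows "P (\<Union>\<PP> - A) = 1 - P A"
proof -
  have "A \<union> (\<Union>\<PP> - A) = \<Union>\<PP>" using assms(3) by (auto dest: events_subset)
  then have "P (\<Union>\<PP>) = P A + P (\<Union>\<PP> - A)"
    using probability_add[OF assms(2,3) events_Diff[OF assms(1,3)]] by auto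
  then show ?thesis using assms(2) unfolding is_probability_def by simp
qed

lemma probability_split:
  assumes "partition_on (\<Union>\<PP>) \<PP>" "is_probability \<PP> P" "A \<in> events \<PP>" "B \<in> events \<PP>"
  shows "P B = P (A \<inter> B) + P ((\<Union>\<PP> - A) \<inter> B)"
proof -
  have "B = (A \<inter> B) \<union> ((\<Union>\<PP> - A) \<inter> B)" using assms(4) by (auto dest: events_subset)
  moreover have "(A \<inter> B) \<inter> ((\<Union>\<PP> - A) \<inter> B) = {}" by auto
  ultimately show ?thesis
    using probability_add[OF assms(2)] assms events_Int events_Diff by metis
qed

lemma probability_mono:
  assumes "partition_on (\<Union>\<PP>) \<PP>" "is_probability \<PP> P" "A \<in> events \<PP>" "B \<in> events \<PP>" "A \<subseteq> B"
  shows "P A \<le> P B"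
proof -
  have "A \<inter> B = A" using assms(5) by auto
  then show ?thesis
    using probability_split[OF assms(1-4)]
      probability_nonneg[OF assms(2) events_Int[OF assms(1) events_Diff[OF assms(1,3)] assms(4)]]
    by simp
qed

text \<open>Supplies the conditional probability chosen in \<open>natural_extension_eq_0\<close>
  when the conditioning event is null.\<close>

lemma point_mass_probability:
  assumes "\<omega> \<in> \<Union>\<PP>"
  shows "is_probability \<PP> (\<lambda>X. of_bool (\<omega> \<in> X))"
  using assms unfolding is_probability_def additive_def by auto

lemma conditional_probability:
  assumes "partition_on (\<Union>\<PP>) \<PP>" "is_probability \<PP> P" "B \<in> events \<PP>" "0 < P B"
  shows "is_probability \<PP> (\<lambda>X. P (X \<inter> B) / P B)"
  unfolding is_probability_def
proof (intro conjI ballI)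
  fix A assume "A \<in> events \<PP>"
  then show "0 \<le> P (A \<inter> B) / P B"
    using assms events_Int probability_nonneg by (metis divide_nonneg_pos)
next
  have "\<Union>\<PP> \<inter> B = B" using assms(3) by (auto dest: events_subset)
  then show "P (\<Union>\<PP> \<inter> B) / P B = 1" using assms(4) by simp
next
  show "additive (events \<PP>) (\<lambda>X. P (X \<inter> B) / P B)"
    unfolding additive_def
  proof (intro ballI impI)
    fix X Y assume XY: "X \<in> events \<PP>" "Y \<in> events \<PP>" "X \<inter> Y = {}"
    have "P ((X \<inter> B) \<union> (Y \<inter> B)) = P (X \<inter> B) + P (Y \<inter> B)"
      using XY assms by (intro probability_add) (auto intro: events_Int)
    then show "P ((X \<union> Y) \<inter> B) / P B = P (X \<inter> B) / P B + P (Y \<inter> B) / P B"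
      by (simp add: Int_Un_distrib2 add_divide_distrib)
  qed
qed

section \<open>Maximal 2-monotone capacities\<close>

text \<open>These are the normalized convex (supermodular) capacities. All conditions compare values
  of \<open>v\<close> directly, with no reference to a family of probabilities, so they can be
  checked for modified functions and for suprema of chains.\<close>

definition monotone_capacity :: "'w set set \<Rightarrow> ('w set \<Rightarrow> real) \<Rightarrow> bool" where
  "monotone_capacity \<PP> v \<longleftrightarrow> v {} = 0 \<and> v (\<Union>\<PP>) = 1 \<and>
     (\<forall>A\<in>events \<PP>. \<forall>C\<in>events \<PP>. A \<subseteq> C \<longrightarrow> v A \<le> v C) \<and> two_monotone \<PP> v"

lemma monotone_capacityI:
  assumes "v {} = 0" "v (\<Union>\<PP>) = 1"
    and "\<And>A C. A \<in> events \<PP> \<Longrightarrow> C \<in> events \<PP> \<Longrightarrow> A \<subseteq> C \<Longrightarrow> v A \<le> v C"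
    and "\<And>A C. A \<in> events \<PP> \<Longrightarrow> C \<in> events \<PP> \<Longrightarrow> v A + v C \<le> v (A \<union> C) + v (A \<inter> C)"
  shows "monotone_capacity \<PP> v"
  using assms unfolding monotone_capacity_def two_monotone_def by simp

lemma monotone_capacity_mono:
  assumes "monotone_capacity \<PP> v" "A \<in> events \<PP>" "C \<in> events \<PP>" "A \<subseteq> C"
  shows "v A \<le> v C"
  using assms unfolding monotone_capacity_def by blast

lemma coherent_monotone_capacity:
  assumes part: "partition_on (\<Union>\<PP>) \<PP>" and coh: "coherent_lower \<PP> lP" and "two_monotone \<PP> lP"
  shows "monotone_capacity \<PP> lP"
proof -
  obtain K where K: "K \<noteq> {}" "\<And>P. P \<in> K \<Longrightarrow> is_probability \<PP> P"
    "\<And>A. A \<in> events \<PP> \<Longrightarrow> lP A = (INF P\<in>K. P A)"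
    using coh unfolding coherent_lower_def by blast
  have "(INF P\<in>K. P {}) = (INF P\<in>K. 0)" "(INF P\<in>K. P (\<Union>\<PP>)) = (INF P\<in>K. 1)"
    by (auto intro!: INF_cong dest!: K(2) simp: probability_empty) (auto simp: is_probability_def)
  then have "lP {} = 0" "lP (\<Union>\<PP>) = 1"
    using K(1) by (simp_all add: K(3) events_empty events_top)
  moreover have "lP A \<le> lP C" if "A \<in> events \<PP>" "C \<in> events \<PP>" "A \<subseteq> C" for A C
  proof -
    have "(INF P\<in>K. P A) \<le> (INF P\<in>K. P C)"
    proof (rule cINF_mono[OF K(1)])
      \<comment> \<open>A real infimum is well behaved only on sets bounded below; nonnegativity
        gives the bound 0.\<close>
      show "bdd_below ((\<lambda>P. P A) ` K)"
        using K(2) probability_nonneg that(1) by (intro bdd_belowI[of _ 0]) auto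
    qed (use probability_mono[OF part K(2)] that in blast)
    then show ?thesis using K(3) that by simp
  qed
  ultimately show ?thesis
    using assms(3) unfolding monotone_capacity_def by blast
qed

lemma monotone_capacity_range:
  assumes "monotone_capacity \<PP> v" "A \<in> events \<PP>"
  shows "0 \<le> v A" "v A \<le> 1"
proof -
  have "v {} \<le> v A" "v A \<le> v (\<Union>\<PP>)"
    using assms events_empty events_top events_subset[OF assms(2)]
    by (auto intro!: monotone_capacity_mono[OF assms(1)])
  then show "0 \<le> v A" "v A \<le> 1"
    using assms(1) unfolding monotone_capacity_def by simp_all
qed

text \<open>If \<open>v {} = 0\<close>, this is \<open>v\<close> itself on events inside
  \<open>C\<close> and the increment \<open>v (X \<union> C) - v C\<close> on events disjoint from
  \<open>C\<close>; a general \<open>X\<close> gets the sum of the values of its parts inside and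
  outside \<open>C\<close>.\<close>

definition additive_across :: "'w set \<Rightarrow> ('w set \<Rightarrow> real) \<Rightarrow> 'w set \<Rightarrow> real" where
  "additive_across C v X = v (X \<union> C) + v (X \<inter> C) - v C"

text \<open>Domination is 2-monotonicity at \<open>X\<close> and \<open>C\<close>, rearranged. The
  2-monotonicity survives because \<open>X \<mapsto> X \<union> C\<close> and
  \<open>X \<mapsto> X \<inter> C\<close> both commute with unions and intersections, so two
  instances for \<open>v\<close> add up to the one required.\<close>

lemma monotone_capacity_additive_across:
  assumes part: "partition_on (\<Union>\<PP>) \<PP>" and v: "monotone_capacity \<PP> v" and C: "C \<in> events \<PP>"
  shows "monotone_capacity \<PP> (additive_across C v)"
    and "X \<in> events \<PP> \<Longrightarrow> v X \<le> additive_across C v X"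
proof -
  have mono: "v X \<le> v Y" if "X \<in> events \<PP>" "Y \<in> events \<PP>" "X \<subseteq> Y" for X Y
    using monotone_capacity_mono[OF v] that .
  have super: "v X + v Y \<le> v (X \<union> Y) + v (X \<inter> Y)" if "X \<in> events \<PP>" "Y \<in> events \<PP>" for X Y
    using v that unfolding monotone_capacity_def two_monotone_def by blast
  show "X \<in> events \<PP> \<Longrightarrow> v X \<le> additive_across C v X"
    using super[of X C] C unfolding additive_across_def by simp
  have "additive_across C v X \<le> additive_across C v Y"
    if "X \<in> events \<PP>" "Y \<in> events \<PP>" "X \<subseteq> Y" for X Y
  proof -
    have "v (X \<union> C) \<le> v (Y \<union> C)" "v (X \<inter> C) \<le> v (Y \<inter> C)"
      using that C by (auto intro!: mono events_Un events_Int[OF part])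
    then show ?thesis unfolding additive_across_def by simp
  qed
  moreover have "additive_across C v X + additive_across C v Y
      \<le> additive_across C v (X \<union> Y) + additive_across C v (X \<inter> Y)"
    if "X \<in> events \<PP>" "Y \<in> events \<PP>" for X Y
  proof -
    have "(X \<union> C) \<union> (Y \<union> C) = X \<union> Y \<union> C" "(X \<union> C) \<inter> (Y \<union> C) = X \<inter> Y \<union> C"
      "(X \<inter> C) \<union> (Y \<inter> C) = (X \<union> Y) \<inter> C" "(X \<inter> C) \<inter> (Y \<inter> C) = X \<inter> Y \<inter> C"
      by auto
    then show ?thesis
      using super[of "X \<union> C" "Y \<union> C"] super[of "X \<inter> C" "Y \<inter> C"] that C events_Un[of _ \<PP>]
        events_Int[OF part]
      unfolding additive_across_def by simp
  qed
  moreover have "\<Union>\<PP> \<union> C = \<Union>\<PP>" "\<Union>\<PP> \<inter> C = C" using events_subset[OF C] by auto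
  then have "additive_across C v {} = 0" "additive_across C v (\<Union>\<PP>) = 1"
    using v unfolding monotone_capacity_def additive_across_def by simp_all
  ultimately show "monotone_capacity \<PP> (additive_across C v)"
    by (intro monotone_capacityI)
qed

section \<open>Dominating probabilities from maximal capacities\<close>

text \<open>Provides the upper bounds for Zorn's lemma. The two suprema on the smaller side of
  2-monotonicity may be approached by different members; the chain condition replaces these by a
  single member, to which 2-monotonicity applies.\<close>

lemma Sup_chain_monotone_capacity:
  fixes K :: "('w set \<Rightarrow> real) set"
  assumes part: "partition_on (\<Union>\<PP>) \<PP>" and K: "K \<noteq> {}" "\<And>v. v \<in> K \<Longrightarrow> monotone_capacity \<PP> v"
    and chain: "\<And>v w. v \<in> K \<Longrightarrow> w \<in> K \<Longrightarrow> v \<le> w \<or> w \<le> v"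
  shows "monotone_capacity \<PP> (\<lambda>X. SUP v\<in>K. v X)"
    and "v \<in> K \<Longrightarrow> X \<in> events \<PP> \<Longrightarrow> v X \<le> (SUP v\<in>K. v X)"
proof -
  have bdd: "bdd_above ((\<lambda>v. v X) ` K)" if "X \<in> events \<PP>" for X
    using K(2) that monotone_capacity_range(2) by (intro bdd_aboveI[of _ 1]) auto
  show upper: "v X \<le> (SUP v\<in>K. v X)" if "v \<in> K" "X \<in> events \<PP>" for v X
    using bdd that by (intro cSUP_upper)
  have "(SUP v\<in>K. v {}) = (SUP v\<in>K. 0)" "(SUP v\<in>K. v (\<Union>\<PP>)) = (SUP v\<in>K. 1)"
    using K(2) unfolding monotone_capacity_def by (auto intro!: SUP_cong)
  then have "(SUP v\<in>K. v {}) = 0" "(SUP v\<in>K. v (\<Union>\<PP>)) = 1"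
    using K(1) by simp_all
  moreover have "(SUP v\<in>K. v X) \<le> (SUP v\<in>K. v Y)"
    if "X \<in> events \<PP>" "Y \<in> events \<PP>" "X \<subseteq> Y" for X Y
  proof (rule cSUP_mono[OF K(1) bdd[OF that(2)]])
    show "\<exists>w\<in>K. v X \<le> w Y" if "v \<in> K" for v
      using K(2)[OF that] \<open>X \<in> events \<PP>\<close> \<open>Y \<in> events \<PP>\<close> \<open>X \<subseteq> Y\<close> that
      unfolding monotone_capacity_def by blast
  qed
  moreover have "(SUP v\<in>K. v X) + (SUP v\<in>K. v Y) \<le> (SUP v\<in>K. v (X \<union> Y)) + (SUP v\<in>K. v (X \<inter> Y))"
    (is "_ \<le> ?r") if XY: "X \<in> events \<PP>" "Y \<in> events \<PP>" for X Y
  proof -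
    have bound: "u X + u Y \<le> ?r" if "u \<in> K" for u
    proof -
      have "u X + u Y \<le> u (X \<union> Y) + u (X \<inter> Y)"
        using K(2)[OF that] XY unfolding monotone_capacity_def two_monotone_def by blast
      also have "\<dots> \<le> ?r"
        using upper[OF that] XY events_Un[of _ \<PP>] events_Int[OF part] by (intro add_mono) auto
      finally show ?thesis .
    qed
    \<comment> \<open>The larger of \<open>v\<close> and \<open>w\<close> bounds both summands, so
      \<open>bound\<close> for that one suffices.\<close>
    have "v X + w Y \<le> ?r" if "v \<in> K" "w \<in> K" for v w
      using chain[OF that] bound[OF that(1)] bound[OF that(2)] le_funD[of v w X] le_funD[of w v Y]
      by fastforce
    \<comment> \<open>Since \<open>?r\<close> depends on neither \<open>v\<close> nor
      \<open>w\<close>, the suprema can be taken one variable at a time.\<close>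
    then have "v X \<le> ?r - w Y" if "v \<in> K" "w \<in> K" for v w
      using that by (simp add: le_diff_eq)
    then have "(SUP v\<in>K. v X) \<le> ?r - w Y" if "w \<in> K" for w
      using that K(1) by (intro cSUP_least) auto
    then have "w Y \<le> ?r - (SUP v\<in>K. v X)" if "w \<in> K" for w
      using that by (simp add: le_diff_eq add.commute)
    then have "(SUP w\<in>K. w Y) \<le> ?r - (SUP v\<in>K. v X)"
      using K(1) by (intro cSUP_least) auto
    then show ?thesis by simp
  qed
  ultimately show "monotone_capacity \<PP> (\<lambda>X. SUP v\<in>K. v X)"
    by (intro monotone_capacityI)
qed

text \<open>A convex capacity has a nonempty credal set. Zorn's lemma covers infinite partitions,
  and finite additivity is all that maximality yields.\<close>

lemma monotone_capacity_dominated: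
  assumes part: "partition_on (\<Union>\<PP>) \<PP>" and v: "monotone_capacity \<PP> v"
  shows "\<exists>P. is_probability \<PP> P \<and> (\<forall>A\<in>events \<PP>. v A \<le> P A)"
proof -
  define z where "z w X = (if X \<in> events \<PP> then w X else 0)" for w :: "'a set \<Rightarrow> real" and X
  have z: "monotone_capacity \<PP> (z w)" if "monotone_capacity \<PP> w" for w
    using that events_empty[of \<PP>] events_top[of \<PP>] events_Un[of _ \<PP>] events_Int[OF part]
    unfolding monotone_capacity_def two_monotone_def z_def by simp
  txt \<open>Vanishing off the events makes the pointwise order on total functions the right one.\<close>
  define M where "M = {w. monotone_capacity \<PP> w \<and> (\<forall>X\<in>events \<PP>. v X \<le> w X) \<and> (\<forall>X. X \<notin> events \<PP> \<longrightarrow> w X = 0)}"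
  have zM: "z w \<in> M" if "monotone_capacity \<PP> w" "\<And>X. X \<in> events \<PP> \<Longrightarrow> v X \<le> w X" for w
    using z[OF that(1)] that(2) unfolding M_def by (simp add: z_def)
  have "\<exists>m\<in>M. \<forall>a\<in>M. m \<le> a \<longrightarrow> a = m"
  proof (rule predicate_Zorn)
    show "partial_order_on M (relation_of (\<le>) M)"
      by (rule partial_order_on_relation_ofI) auto
    fix K assume "K \<in> Chains (relation_of (\<le>) M)"
    then have K: "K \<subseteq> M" "\<And>v w. v \<in> K \<Longrightarrow> w \<in> K \<Longrightarrow> v \<le> w \<or> w \<le> v"
      unfolding Chains_def relation_of_def by auto
    show "\<exists>u\<in>M. \<forall>a\<in>K. a \<le> u"
    proof (cases "K = {}")
      case True
      \<comment> \<open>The empty chain needs a bound too: the truncation of \<open>v\<close> shows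
        that \<open>M\<close> is nonempty.\<close>
      then show ?thesis using zM[OF v] by blast
    next
      case False
      let ?u = "\<lambda>X. SUP w\<in>K. w X"
      have cap: "\<And>w. w \<in> K \<Longrightarrow> monotone_capacity \<PP> w" using K(1) unfolding M_def by blast
      note sup = Sup_chain_monotone_capacity[OF part False cap K(2)]
      obtain w where "w \<in> K" using False by blast
      then have "v X \<le> ?u X" if "X \<in> events \<PP>" for X
        using sup(2)[of w X] K(1) that unfolding M_def by fastforce
      then have "z ?u \<in> M" using zM sup(1) by blast
      moreover have "a \<le> z ?u" if "a \<in> K" for a
        using that sup(2)[of a] K(1) unfolding z_def M_def le_fun_def by auto
      ultimately show ?thesis by blast
    qed
  qed
  then obtain m where m: "m \<in> M" and max: "\<And>a. a \<in> M \<Longrightarrow> m \<le> a \<Longrightarrow> a = m" by blast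
  have cap: "monotone_capacity \<PP> m" and vm: "\<And>X. X \<in> events \<PP> \<Longrightarrow> v X \<le> m X"
    and off: "\<And>X. X \<notin> events \<PP> \<Longrightarrow> m X = 0"
    using m unfolding M_def by auto
  \<comment> \<open>By maximality \<open>m\<close> equals its truncated
    \<open>additive_across C\<close>. At an \<open>X\<close> disjoint from \<open>C\<close> this
    equation reads \<open>m X = m (X \<union> C) - m C\<close>.\<close>
  have "m (X \<union> C) = m X + m C" if X: "X \<in> events \<PP>" and C: "C \<in> events \<PP>" and XC: "X \<inter> C = {}" for X C
  proof -
    note across = monotone_capacity_additive_across[OF part cap C]
    have "z (additive_across C m) \<in> M"
      using zM[OF across(1)] across(2) vm order_trans by blast
    moreover have "m \<le> z (additive_across C m)"
      using across(2) off unfolding z_def le_fun_def by simp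
    ultimately have "z (additive_across C m) X = m X" using max by metis
    then show ?thesis
      using X XC cap unfolding z_def additive_across_def monotone_capacity_def by simp
  qed
  then have "additive (events \<PP>) m"
    unfolding additive_def by simp
  then have "is_probability \<PP> m"
    using cap monotone_capacity_range(1)[OF cap]
    unfolding is_probability_def monotone_capacity_def by simp
  then show ?thesis using vm by blast
qed

text \<open>Additivity across an event raises the value of its complement to the largest compatible
  amount. A dominating probability then cannot exceed the lower value at the event itself, and
  domination gives equality. Taking \<open>C = D\<close> handles a single event.\<close>

lemma credal_set_attains_chain:
  assumes part: "partition_on (\<Union>\<PP>) \<PP>" and v: "monotone_capacity \<PP> v"
    and C: "C \<in> events \<PP>" and D: "D \<in> events \<PP>" and CD: "C \<subseteq> D"
  obtains P where "P \<in> credal_set \<PP> v" "P C = v C" "P D = v D"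
proof -
  define v1 where "v1 = additive_across C v"
  define v2 where "v2 = additive_across D v1"
  note c1 = monotone_capacity_additive_across[OF part v C, folded v1_def]
  note c2 = monotone_capacity_additive_across[OF part c1(1) D, folded v2_def]
  obtain P where P: "is_probability \<PP> P" "\<And>A. A \<in> events \<PP> \<Longrightarrow> v2 A \<le> P A"
    using monotone_capacity_dominated[OF part c2(1)] by blast
  have dom: "v A \<le> P A" if "A \<in> events \<PP>" for A
    using c1(2)[OF that] c2(2)[OF that] P(2)[OF that] by simp
  have norm: "v {} = 0" "v (\<Union>\<PP>) = 1" "v1 {} = 0" "v1 (\<Union>\<PP>) = 1"
    using v c1(1) unfolding monotone_capacity_def by auto
  have sets: "\<Union>\<PP> - C \<union> C = \<Union>\<PP>" "\<Union>\<PP> - D \<union> D = \<Union>\<PP>" "(\<Union>\<PP> - C) \<inter> C = {}" "(\<Union>\<PP> - D) \<inter> D = {}"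
    "D \<union> C = D" "D \<inter> C = C"
    using events_subset[OF C] events_subset[OF D] CD by auto
  \<comment> \<open>The inclusion of \<open>C\<close> in \<open>D\<close> enters through
    \<open>v1 D = v D\<close>: the first modification leaves the value at \<open>D\<close>
    unchanged, so the second one pins down the original value.\<close>
  have "v1 (\<Union>\<PP> - C) = 1 - v C" "v1 D = v D" "v2 (\<Union>\<PP> - D) = 1 - v1 D"
    unfolding v2_def additive_across_def sets norm unfolding v1_def additive_across_def sets norm by auto
  moreover have "v1 (\<Union>\<PP> - C) \<le> P (\<Union>\<PP> - C)" "v2 (\<Union>\<PP> - D) \<le> P (\<Union>\<PP> - D)"
    using c2(2) P(2) events_Diff[OF part C] events_Diff[OF part D] order_trans by blast+
  ultimately have "P C \<le> v C" "P D \<le> v D"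
    using probability_compl[OF part P(1)] C D by auto
  then have "P C = v C" "P D = v D" using dom C D by (simp_all add: antisym)
  moreover have "P \<in> credal_set \<PP> v" using P(1) dom unfolding credal_set_def by blast
  ultimately show ?thesis using that by blast
qed

section \<open>The two extensions\<close>

lemma credal_set_le_conj_upper:
  assumes "partition_on (\<Union>\<PP>) \<PP>" "P \<in> credal_set \<PP> lP" "A \<in> events \<PP>"
  shows "P A \<le> conj_upper \<PP> lP A"
proof -
  have "lP (\<Union>\<PP> - A) \<le> P (\<Union>\<PP> - A)"
    using assms events_Diff unfolding credal_set_def by blast
  then show ?thesis
    using probability_compl[OF assms(1) _ assms(3)] assms(2)
    unfolding conj_upper_def credal_set_def by fastforce
qed

lemma cond_mem_conditional_extensions:
  assumes "partition_on (\<Union>\<PP>) \<PP>" "P \<in> credal_set \<PP> lP" "B \<in> events \<PP>" "0 < P B"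
  shows "(P, \<lambda>X. P (X \<inter> B) / P B) \<in> conditional_extensions \<PP> lP B"
proof -
  have "is_probability \<PP> (\<lambda>X. P (X \<inter> B) / P B)"
    using assms by (intro conditional_probability) (auto simp: credal_set_def)
  then show ?thesis
    using assms(2,4) unfolding conditional_extensions_def by simp
qed

text \<open>Every member of the credal set is positive at \<open>B\<close>, so the product rule
  determines \<open>Q A\<close> as a quotient. Both infima then range over the same set of
  reals.\<close>

lemma regular_eq_natural_if_lower_pos:
  assumes part: "partition_on (\<Union>\<PP>) \<PP>" and B: "B \<in> events \<PP>" and A: "A \<in> events \<PP>" and "0 < lP B"
  shows "regular_extension \<PP> lP A B = natural_extension \<PP> lP A B"
proof -
  have pos: "0 < P B" if "P \<in> credal_set \<PP> lP" for P
    using that B assms(4) unfolding credal_set_def by fastforce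
  then have eq: "credal_set_pos \<PP> lP B = credal_set \<PP> lP"
    unfolding credal_set_pos_def by blast
  have "(\<lambda>P. P (A \<inter> B) / P B) ` credal_set \<PP> lP = (\<lambda>(P, Q). Q A) ` conditional_extensions \<PP> lP B"
  proof (intro equalityI subsetI)
    fix y assume "y \<in> (\<lambda>P. P (A \<inter> B) / P B) ` credal_set \<PP> lP"
    then show "y \<in> (\<lambda>(P, Q). Q A) ` conditional_extensions \<PP> lP B"
      using cond_mem_conditional_extensions[OF part _ B] pos by force
  next
    fix y assume "y \<in> (\<lambda>(P, Q). Q A) ` conditional_extensions \<PP> lP B"
    then obtain P Q where PQ: "(P, Q) \<in> conditional_extensions \<PP> lP B" "y = Q A" by auto
    then have P: "P \<in> credal_set \<PP> lP" and "P (A \<inter> B) = Q A * P B"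
      using A unfolding conditional_extensions_def by auto
    then have "y = P (A \<inter> B) / P B" using pos[OF P] PQ(2) by simp
    then show "y \<in> (\<lambda>P. P (A \<inter> B) / P B) ` credal_set \<PP> lP" using P by blast
  qed
  then show ?thesis
    unfolding regular_extension_def natural_extension_def eq by simp
qed

section \<open>The extreme values 0 and 1 of the two extensions\<close>

text \<open>Monotonicity squeezes \<open>Q A\<close> between \<open>Q B = 1\<close> and 1.
  Nonemptiness ensures that the infimum of the constant 1 is 1.\<close>

lemma natural_extension_eq_1:
  assumes part: "partition_on (\<Union>\<PP>) \<PP>" and B: "B \<in> events \<PP>" and A: "A \<in> events \<PP>" and "B \<subseteq> A"
    and ne: "conditional_extensions \<PP> lP B \<noteq> {}"
  shows "natural_extension \<PP> lP A B = 1"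
proof -
  have "Q A = 1" if "(P, Q) \<in> conditional_extensions \<PP> lP B" for P Q
  proof -
    have Q: "is_probability \<PP> Q" "Q B = 1" using that unfolding conditional_extensions_def by auto
    have "Q A \<le> Q (\<Union>\<PP>)"
      using probability_mono[OF part Q(1) A events_top] events_subset[OF A] by blast
    then show ?thesis
      using probability_mono[OF part Q(1) B A \<open>B \<subseteq> A\<close>] Q unfolding is_probability_def by simp
  qed
  then have "natural_extension \<PP> lP A B = (INF PQ\<in>conditional_extensions \<PP> lP B. 1)"
    unfolding natural_extension_def by (intro INF_cong) auto
  then show ?thesis using ne by simp
qed

text \<open>For a \<open>P\<close> null at \<open>B\<close> the product rule reads
  \<open>0 = 0\<close> and admits every \<open>Q\<close> with \<open>Q B = 1\<close>. The point mass
  at a point of \<open>B\<close> outside \<open>A\<close> attains the value 0.\<close>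

lemma natural_extension_eq_0:
  assumes part: "partition_on (\<Union>\<PP>) \<PP>" and B: "B \<in> events \<PP>" and A: "A \<in> events \<PP>"
    and P: "P \<in> credal_set \<PP> lP" "P B = 0" and "\<not> B \<subseteq> A"
  shows "natural_extension \<PP> lP A B = 0"
proof -
  obtain \<omega> where \<omega>: "\<omega> \<in> B" "\<omega> \<notin> A" using assms(6) by blast
  define Q :: "'a set \<Rightarrow> real" where "Q X = of_bool (\<omega> \<in> X)" for X
  have prob: "is_probability \<PP> P" using P(1) unfolding credal_set_def by blast
  have "P (X \<inter> B) = 0" if "X \<in> events \<PP>" for X
    using probability_mono[OF part prob events_Int[OF part that B] B]
      probability_nonneg[OF prob events_Int[OF part that B]] P(2) by simp
  moreover have "is_probability \<PP> Q"
    unfolding Q_def using point_mass_probability[of \<omega> \<PP>] \<omega>(1) events_subset[OF B] by blast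
  ultimately have "(P, Q) \<in> conditional_extensions \<PP> lP B"
    using P \<omega>(1) unfolding conditional_extensions_def Q_def by simp
  moreover have "0 \<le> Q' A" if "(P', Q') \<in> conditional_extensions \<PP> lP B" for P' Q'
    using that probability_nonneg[OF _ A] unfolding conditional_extensions_def by auto
  moreover have "Q A = 0" using \<omega>(2) unfolding Q_def by simp
  ultimately show ?thesis
    unfolding natural_extension_def by (intro cInf_eq_minimum) force+
qed

text \<open>When \<open>B - A\<close> is null under every member,
  \<open>P (A \<inter> B) = P B\<close>, so all quotients are 1. This serves both for empty
  \<open>B - A\<close> and for nonempty \<open>B - A\<close> of upper probability 0.\<close>

lemma regular_extension_eq_1:
  assumes part: "partition_on (\<Union>\<PP>) \<PP>" and B: "B \<in> events \<PP>" and A: "A \<in> events \<PP>"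
    and ne: "credal_set_pos \<PP> lP B \<noteq> {}"
    and null: "\<And>P. P \<in> credal_set \<PP> lP \<Longrightarrow> P ((\<Union>\<PP> - A) \<inter> B) = 0"
  shows "regular_extension \<PP> lP A B = 1"
proof -
  have "P (A \<inter> B) / P B = 1" if "P \<in> credal_set_pos \<PP> lP B" for P
  proof -
    have "P \<in> credal_set \<PP> lP" "is_probability \<PP> P" "0 < P B"
      using that unfolding credal_set_pos_def credal_set_def by auto
    then show ?thesis using probability_split[OF part _ A B, of P] null by simp
  qed
  then have "(INF P\<in>credal_set_pos \<PP> lP B. P (A \<inter> B) / P B) = (INF P\<in>credal_set_pos \<PP> lP B. 1)"
    by (intro INF_cong) auto
  then show ?thesis using ne unfolding regular_extension_def by simp
qed

lemma regular_extension_eq_0: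
  assumes part: "partition_on (\<Union>\<PP>) \<PP>" and B: "B \<in> events \<PP>" and A: "A \<in> events \<PP>"
    and P: "P \<in> credal_set_pos \<PP> lP B" "P (A \<inter> B) = 0"
  shows "regular_extension \<PP> lP A B = 0"
proof -
  have "0 \<le> P' (A \<inter> B) / P' B" if "P' \<in> credal_set_pos \<PP> lP B" for P'
    using that probability_nonneg[OF _ events_Int[OF part A B]]
    unfolding credal_set_pos_def credal_set_def by simp
  then have "(INF P\<in>credal_set_pos \<PP> lP B. P (A \<inter> B) / P B) = 0"
    using P by (intro cInf_eq_minimum) force+
  then show ?thesis using P unfolding regular_extension_def by auto
qed

theorem proposition7p2:
  fixes \<Omega> :: "'w set" and \<PP> :: "'w set set" and lP :: "'w set \<Rightarrow> real" and A B :: "'w set"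
  assumes "partition_on \<Omega> \<PP>"
    and "coherent_lower \<PP> lP"
    and "two_monotone \<PP> lP"
    and "B \<in> events \<PP> - {{}}"
    and "A \<in> events \<PP>"
  shows "(regular_extension \<PP> lP A B \<noteq> natural_extension \<PP> lP A B \<longleftrightarrow>
            0 = lP B \<and> lP B < conj_upper \<PP> lP B \<and>
            (\<Omega> - A) \<inter> B \<noteq> {} \<and>
            conj_upper \<PP> lP ((\<Omega> - A) \<inter> B) = 0) \<and>
         (regular_extension \<PP> lP A B \<noteq> natural_extension \<PP> lP A B \<longrightarrow>
            regular_extension \<PP> lP A B = 1 \<and> 1 > (0::real) \<and>
            0 = natural_extension \<PP> lP A B)"
proof -
  note part = partition_on_UNION(1)[OF assms(1)] and \<Omega> = partition_on_UNION(2)[OF assms(1)]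
  note cap = coherent_monotone_capacity[OF part assms(2,3)]
  have A: "A \<in> events \<PP>" and B: "B \<in> events \<PP>" using assms by auto
  let ?N = "(\<Union>\<PP> - A) \<inter> B"
  have AB: "A \<inter> B \<in> events \<PP>" and N: "?N \<in> events \<PP>"
    using A B events_Int[OF part] events_Diff[OF part] by auto
  have prob: "is_probability \<PP> P" if "P \<in> credal_set \<PP> lP" for P
    using that unfolding credal_set_def by blast
  have subset_iff: "B \<subseteq> A \<longleftrightarrow> ?N = {}" using events_subset[OF B] by blast
  consider "0 < lP B" | "conj_upper \<PP> lP B \<le> 0" | "lP B = 0" "0 < conj_upper \<PP> lP B"
    using monotone_capacity_range(1)[OF cap B] by linarith
  then show ?thesis
  proof cases
    case 1
    then show ?thesis using regular_eq_natural_if_lower_pos[OF part B A] by auto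
  next
    case 2
    \<comment> \<open>The upper probability bounds every member of the credal set at
      \<open>B\<close>, so the regular extension takes its default value, the natural
      extension.\<close>
    then have "credal_set_pos \<PP> lP B = {}"
      using credal_set_le_conj_upper[OF part _ B] unfolding credal_set_pos_def by fastforce
    then have "regular_extension \<PP> lP A B = natural_extension \<PP> lP A B"
      unfolding regular_extension_def by simp
    then show ?thesis using 2 by auto
  next
    case 3
    obtain P0 where P0: "P0 \<in> credal_set \<PP> lP" "P0 B = 0"
      using credal_set_attains_chain[OF part cap B B order_refl] 3(1) by metis
    \<comment> \<open>Attaining the lower probability at the complement of \<open>B\<close> means
      attaining the upper probability at \<open>B\<close>, which is positive here.\<close>
    obtain P1 where P1: "P1 \<in> credal_set \<PP> lP" "P1 (\<Union>\<PP> - B) = lP (\<Union>\<PP> - B)"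
      using credal_set_attains_chain[OF part cap events_Diff[OF part B] events_Diff[OF part B] order_refl]
      by metis
    have "0 < P1 B"
      using probability_compl[OF part prob[OF P1(1)] B] P1(2) 3(2) unfolding conj_upper_def by simp
    then have P1pos: "P1 \<in> credal_set_pos \<PP> lP B" using P1(1) unfolding credal_set_pos_def by simp
    show ?thesis
    proof (cases "?N = {}")
      case True
      have "P ?N = 0" if "P \<in> credal_set \<PP> lP" for P
        unfolding True using probability_empty prob that by blast
      then have "regular_extension \<PP> lP A B = 1"
        using regular_extension_eq_1[OF part B A] P1pos by blast
      moreover have "natural_extension \<PP> lP A B = 1"
        using natural_extension_eq_1[OF part B A, of lP] subset_iff True
          cond_mem_conditional_extensions[OF part P1(1) B \<open>0 < P1 B\<close>] by auto
      ultimately show ?thesis using True \<Omega> by simp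
    next
      case False
      have nat: "natural_extension \<PP> lP A B = 0"
        using natural_extension_eq_0[OF part B A P0] subset_iff False by blast
      show ?thesis
      proof (cases "conj_upper \<PP> lP ?N = 0")
        \<comment> \<open>This is the only branch where the extensions differ: \<open>P0\<close>
          forces the natural extension to 0, while every quotient in the regular extension is
          1.\<close>
        case True
        have "P ?N = 0" if "P \<in> credal_set \<PP> lP" for P
          using credal_set_le_conj_upper[OF part that N] True
            probability_nonneg[OF prob[OF that] N] by simp
        then have "regular_extension \<PP> lP A B = 1"
          using regular_extension_eq_1[OF part B A] P1pos by blast
        then show ?thesis using nat True False 3 \<Omega> by simp
      next
        case False
        have "A \<inter> B \<subseteq> \<Union>\<PP> - ?N" using events_subset[OF A] by blast
        \<comment> \<open>One \<open>P\<close> must serve two purposes: it vanishes at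
          \<open>A \<inter> B\<close>, because \<open>lP (A \<inter> B) \<le> lP B = 0\<close>, and
          attains the positive upper probability at \<open>?N\<close>. Hence \<open>P B > 0\<close>
          with quotient 0.\<close>
        then obtain P where P: "P \<in> credal_set \<PP> lP" "P (A \<inter> B) = lP (A \<inter> B)"
          "P (\<Union>\<PP> - ?N) = lP (\<Union>\<PP> - ?N)"
          using credal_set_attains_chain[OF part cap AB events_Diff[OF part N]] by metis
        have "P ?N = conj_upper \<PP> lP ?N"
          using probability_compl[OF part prob[OF P(1)] N] P(3) unfolding conj_upper_def by simp
        then have "0 < P ?N"
          using False probability_nonneg[OF prob[OF P(1)] N] by simp
        moreover have "lP (A \<inter> B) \<le> lP B"
          using cap AB B unfolding monotone_capacity_def by blast
        then have "P (A \<inter> B) = 0"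
          using P(2) 3(1) monotone_capacity_range(1)[OF cap AB] by simp
        ultimately have "P \<in> credal_set_pos \<PP> lP B"
          using probability_split[OF part prob[OF P(1)] A B] P(1)
          unfolding credal_set_pos_def by simp
        then have "regular_extension \<PP> lP A B = 0"
          using regular_extension_eq_0[OF part B A] \<open>P (A \<inter> B) = 0\<close> by blast
        then show ?thesis using nat False \<Omega> by simp
      qed
    qed
  qed
qed

end
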